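(* Let $p\ge 0$ be a fixed integer, and let $\mathcal{F}$ be the set of all forbidden induced subgraphs for the class of $p$-edge-add chordal graphs that are not cycles. Then $\mathcal{F}$ is finite.
   Context: All graphs are simple, finite and undirected. A graph is chordal if it has no induced cycle of length greater than three. A graph $G$ is $p$-edge-add chordal if a chordal graph can be obtained from $G$ by adding at most $p$ non-edges (edges of the complement) of $G$. A forbidden induced subgraph for a hereditary class (closed under induced subgraphs) is a graph not in the class all of whose proper induced subgraphs are in the class. *)

theory Defs
  imports Main
begin

record 'a ugraph =
  verts :: "'a set"
  edges :: "'a set set"

definition simple_graph :: "'a ugraph \<Rightarrow> bool" where
  "simple_graph G \<longleftrightarrow> finite (verts G) \<and> (\<forall>e\<in>edges G. e \<subseteq> verts G \<and> card e = 2)"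

definition induced_subgraph :: "'a ugraph \<Rightarrow> 'a set \<Rightarrow> 'a ugraph" where
  "induced_subgraph G S = \<lparr>verts = S, edges = {e \<in> edges G. e \<subseteq> S}\<rparr>"

text \<open>The two graphs may live on different vertex types.\<close>

definition graph_iso :: "'a ugraph \<Rightarrow> 'b ugraph \<Rightarrow> bool" where
  "graph_iso G H \<longleftrightarrow>
     (\<exists>f. bij_betw f (verts G) (verts H) \<and>
          (\<forall>u\<in>verts G. \<forall>v\<in>verts G. {u, v} \<in> edges G \<longleftrightarrow> {f u, f v} \<in> edges H))"

definition iso_rel :: "('a ugraph \<times> 'a ugraph) set" where
  "iso_rel = {(G, H). simple_graph G \<and> simple_graph H \<and> graph_iso G H}"

text \<open>This is the cycle of length \<open>n\<close> only for \<open>n \<ge> 3\<close>; every use below carries that bound.\<close>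

definition cycle_graph :: "nat \<Rightarrow> nat ugraph" where
  "cycle_graph n = \<lparr>verts = {..<n}, edges = {{i, Suc i mod n} | i. i < n}\<rparr>"

definition is_cycle :: "'a ugraph \<Rightarrow> bool" where
  "is_cycle G \<longleftrightarrow> (\<exists>n\<ge>3. graph_iso G (cycle_graph n))"

definition chordal :: "'a ugraph \<Rightarrow> bool" where
  "chordal G \<longleftrightarrow>
     \<not> (\<exists>S n. S \<subseteq> verts G \<and> n > 3 \<and> graph_iso (induced_subgraph G S) (cycle_graph n))"

definition non_edges :: "'a ugraph \<Rightarrow> 'a set set" where
  "non_edges G = {e. e \<subseteq> verts G \<and> card e = 2 \<and> e \<notin> edges G}"

definition add_edges :: "'a ugraph \<Rightarrow> 'a set set \<Rightarrow> 'a ugraph" where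
  "add_edges G A = \<lparr>verts = verts G, edges = edges G \<union> A\<rparr>"

definition edge_add_chordal :: "nat \<Rightarrow> 'a ugraph set" where
  "edge_add_chordal p =
     {G. simple_graph G \<and> (\<exists>A\<subseteq>non_edges G. card A \<le> p \<and> chordal (add_edges G A))}"

definition hereditary :: "'a ugraph set \<Rightarrow> bool" where
  "hereditary \<C> \<longleftrightarrow> (\<forall>G\<in>\<C>. \<forall>S\<subseteq>verts G. induced_subgraph G S \<in> \<C>)"

definition forbidden_induced_subgraphs :: "'a ugraph set \<Rightarrow> 'a ugraph set" where
  "forbidden_induced_subgraphs \<C> =
     {G. simple_graph G \<and> G \<notin> \<C> \<and> (\<forall>S. S \<subset> verts G \<longrightarrow> induced_subgraph G S \<in> \<C>)}"

lemma simple_graph_induced: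
  "simple_graph G \<Longrightarrow> S \<subseteq> verts G \<Longrightarrow> simple_graph (induced_subgraph G S)"
  by (auto simp: simple_graph_def induced_subgraph_def intro: finite_subset)

lemma hereditary_edge_add_chordal: "hereditary (edge_add_chordal p)"
  unfolding hereditary_def
proof (intro ballI allI impI)
  fix G :: "'a ugraph" and S
  assume G: "G \<in> edge_add_chordal p" and S: "S \<subseteq> verts G"
  then obtain A where sG: "simple_graph G" and A: "A \<subseteq> non_edges G" "card A \<le> p"
    and ch: "chordal (add_edges G A)"
    by (auto simp: edge_add_chordal_def)
  define B where "B = {e \<in> A. e \<subseteq> S}"
  have "non_edges G \<subseteq> Pow (verts G)" by (auto simp: non_edges_def)
  with sG A have "finite A"
    by (meson finite_Pow_iff finite_subset simple_graph_def)
  then have "card B \<le> p"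
    using A(2) card_mono[of A B] by (auto simp: B_def)
  moreover have "B \<subseteq> non_edges (induced_subgraph G S)"
    using A(1) by (auto simp: B_def non_edges_def induced_subgraph_def)
  moreover have "induced_subgraph (add_edges (induced_subgraph G S) B) T
      = induced_subgraph (add_edges G A) T" if "T \<subseteq> S" for T
    using that by (auto simp: induced_subgraph_def add_edges_def B_def)
  with ch S have "chordal (add_edges (induced_subgraph G S) B)"
    unfolding chordal_def
    by (metis (no_types, lifting) add_edges_def induced_subgraph_def order_trans ugraph.select_convs(1))
  ultimately show "induced_subgraph G S \<in> edge_add_chordal p"
    using simple_graph_induced[OF sG S] by (auto simp: edge_add_chordal_def)
qed

lemma graph_iso_refl: "graph_iso G G"
  unfolding graph_iso_def by (intro exI[of _ id]) auto

lemma graph_iso_sym: "graph_iso G H \<Longrightarrow> graph_iso H G"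
  unfolding graph_iso_def
proof (elim exE conjE)
  fix f assume f: "bij_betw f (verts G) (verts H)"
    and e: "\<forall>u\<in>verts G. \<forall>v\<in>verts G. ({u, v} \<in> edges G) = ({f u, f v} \<in> edges H)"
  let ?g = "inv_into (verts G) f"
  have "bij_betw ?g (verts H) (verts G)" using f by (rule bij_betw_inv_into)
  moreover have "?g u \<in> verts G \<and> f (?g u) = u" if "u \<in> verts H" for u
    using f that by (meson bij_betwE bij_betw_inv_into bij_betw_inv_into_right)
  ultimately show "\<exists>f. bij_betw f (verts H) (verts G) \<and>
      (\<forall>u\<in>verts H. \<forall>v\<in>verts H. ({u, v} \<in> edges H) = ({f u, f v} \<in> edges G))"
    using e by (intro exI[of _ ?g]) auto
qed

lemma graph_iso_trans: "graph_iso G H \<Longrightarrow> graph_iso H K \<Longrightarrow> graph_iso G K"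
  unfolding graph_iso_def
proof (elim exE conjE)
  fix f g assume f: "bij_betw f (verts G) (verts H)" and g: "bij_betw g (verts H) (verts K)"
    and "\<forall>u\<in>verts G. \<forall>v\<in>verts G. ({u, v} \<in> edges G) = ({f u, f v} \<in> edges H)"
    and "\<forall>u\<in>verts H. \<forall>v\<in>verts H. ({u, v} \<in> edges H) = ({g u, g v} \<in> edges K)"
  then show "\<exists>f. bij_betw f (verts G) (verts K) \<and>
      (\<forall>u\<in>verts G. \<forall>v\<in>verts G. ({u, v} \<in> edges G) = ({f u, f v} \<in> edges K))"
    using bij_betwE[OF f] by (intro exI[of _ "g \<circ> f"]) (auto intro: bij_betw_trans)
qed

lemma equiv_iso_rel: "equiv {G. simple_graph G} iso_rel"
  by (rule equivI)
    (auto simp: iso_rel_def refl_on_def sym_def trans_def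
      intro: graph_iso_refl graph_iso_sym graph_iso_trans)

end

(* Call an induced cycle of length at least four a hole, and let G be a minimal obstruction that is
   not itself a cycle. Every hole of G is a proper induced subgraph, hence has a fill of at most p
   edges, and therefore at most 4p vertices.

   As in the Kaplan-Shamir-Tarjan kernel for minimum fill-in, collect holes into a set U until no
   hole has two consecutive vertices outside U; each hole added forces a new fill edge, so U is
   bounded. If for a non-adjacent pair u, v in U there are more than 2p vertices b such that u, b, v
   are consecutive on a hole, then every fill with at most p edges contains uv. Let S consist of U
   and, for every pair in U, the holes through up to 2p + 1 such vertices b.

   If S were a proper subset of the vertices, G[S] would have a fill F with at most p edges. Adding a
   maximal set of forced edges that creates no new hole corner outside U leaves all holes inside S,
   and adding chords of holes never makes a new vertex lie on a hole. Hence a subset of F already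
   makes G chordal, a contradiction. *)

theory Submission
  imports Defs
begin

section \<open>Reachability, corners and holes for bare edge sets\<close>

definition linked :: "'a set set \<Rightarrow> 'a set \<Rightarrow> 'a \<Rightarrow> 'a \<Rightarrow> bool" where
  "linked E D = (\<lambda>a b. {a, b} \<in> E \<and> a \<in> D \<and> b \<in> D)\<^sup>*\<^sup>*"

text \<open>The vertices that an induced cycle through \<open>b\<close> may use besides
  \<open>b\<close> itself when \<open>x\<close> and \<open>y\<close> are the neighbours of
  \<open>b\<close> on it.\<close>

definition away :: "'a set set \<Rightarrow> 'a \<Rightarrow> 'a \<Rightarrow> 'a \<Rightarrow> 'a set" where
  "away E b x y = {w. w \<noteq> b \<and> ({b, w} \<notin> E \<or> w = x \<or> w = y)}"

text \<open>\<open>corner E x b y\<close> says that \<open>x\<close>, \<open>b\<close>, \<open>y\<close> are consecutive on an induced cycle of length at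
  least four (\<open>corner_hole\<close>, \<open>hole_imp_corner\<close>). Expressed by connectivity in the set of vertices
  away from \<open>b\<close>, it can be transferred between graphs without handling cycles.\<close>

definition corner :: "'a set set \<Rightarrow> 'a \<Rightarrow> 'a \<Rightarrow> 'a \<Rightarrow> bool" where
  "corner E x b y \<longleftrightarrow> {b, x} \<in> E \<and> {b, y} \<in> E \<and> x \<noteq> y \<and> {x, y} \<notin> E \<and>
     linked E (away E b x y) x y"

text \<open>Holes are labelled so that the neighbours of \<open>c 0\<close> on the hole are
  \<open>c 1\<close> and \<open>c (n - 1)\<close>; a rotation brings any other vertex to index
  0.\<close>

definition hole :: "'a set set \<Rightarrow> nat \<Rightarrow> (nat \<Rightarrow> 'a) \<Rightarrow> bool" where
  "hole E n c \<longleftrightarrow> 4 \<le> n \<and> inj_on c {..<n} \<and>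
     (\<forall>i<n. \<forall>j<n. {c i, c j} \<in> E \<longleftrightarrow> j = Suc i mod n \<or> i = Suc j mod n)"

text \<open>Graphs are handled through their edge sets alone: adding a fill is then a union, and
  passing to the subgraph induced on \<open>S\<close> is \<open>E \<inter> Pow S\<close>.\<close>

definition pairs :: "'a set set \<Rightarrow> bool" where
  "pairs E \<longleftrightarrow> (\<forall>e\<in>E. card e = 2)"

lemma pairs_irrefl: "pairs E \<Longrightarrow> {u, u} \<notin> E"
  by (auto simp: pairs_def)

lemma pairs_neq: "pairs E \<Longrightarrow> {u, v} \<in> E \<Longrightarrow> u \<noteq> v"
  by (auto simp: pairs_def)

lemma pairs_subset: "pairs E \<Longrightarrow> F \<subseteq> E \<Longrightarrow> pairs F"
  by (auto simp: pairs_def)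

subsection \<open>Connectivity and corners\<close>

lemma linked_refl [simp]: "linked E D x x"
  by (simp add: linked_def)

lemma linked_edge: "{x, y} \<in> E \<Longrightarrow> x \<in> D \<Longrightarrow> y \<in> D \<Longrightarrow> linked E D x y"
  by (auto simp: linked_def)

lemma linked_trans: "linked E D x y \<Longrightarrow> linked E D y z \<Longrightarrow> linked E D x z"
  by (auto simp: linked_def)

lemma linked_sym:
  assumes "linked E D x y"
  shows "linked E D y x"
  using assms unfolding linked_def
proof (induction rule: rtranclp_induct)
  case (step y z)
  then show ?case
    by (intro converse_rtranclp_into_rtranclp[OF _ step.IH]) (simp add: insert_commute)
qed simp

lemma linked_mono: "linked E D x y \<Longrightarrow> E \<subseteq> E' \<Longrightarrow> D \<subseteq> D' \<Longrightarrow> linked E' D' x y"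
  unfolding linked_def by (erule rtranclp_mono[THEN predicate2D, rotated]) auto

lemma linked_seq:
  assumes "i \<le> j" "\<And>k. i \<le> k \<Longrightarrow> k < j \<Longrightarrow> {c k, c (Suc k)} \<in> E"
    "\<And>k. i \<le> k \<Longrightarrow> k \<le> j \<Longrightarrow> c k \<in> D"
  shows "linked E D (c i) (c j)"
  using assms
proof (induction j rule: dec_induct)
  case (step m)
  then have "linked E D (c i) (c m)" "linked E D (c m) (c (Suc m))"
    by (auto intro!: linked_edge)
  then show ?case by (rule linked_trans)
qed simp

lemma linked_restrict:
  assumes "linked (E \<inter> Pow S) D x y"
  shows "linked E (D \<inter> S) x y"
  using assms unfolding linked_def by (rule rtranclp_mono[THEN predicate2D, rotated]) auto

text \<open>Follow the walk from \<open>u\<close> and stop at its first vertex in \<open>N\<close>,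
  if there is one; everything before that vertex avoids \<open>N\<close>.\<close>

lemma linked_first_hit:
  assumes "linked E D u v" "u \<in> D" "u \<notin> N"
  shows "linked E (D - N) u v \<or> (\<exists>q\<in>N \<inter> D. linked E (insert q (D - N)) u q)"
  using assms(1) unfolding linked_def[of E D]
proof (induction rule: rtranclp_induct)
  case base
  then show ?case by simp
next
  case (step y z)
  show ?case
  proof (cases "\<exists>q\<in>N \<inter> D. linked E (insert q (D - N)) u q")
    case False
    then have uy: "linked E (D - N) u y" using step by blast
    have yN: "y \<in> D - N"
      using uy assms(2,3) unfolding linked_def by (induction rule: rtranclp_induct) auto
    show ?thesis
    proof (cases "z \<in> N")
      case True
      have "linked E (insert z (D - N)) u z"
        using linked_mono[OF uy order_refl subset_insertI] step(2) yN
        by (meson insertCI linked_edge linked_trans)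
      then show ?thesis using True step(2) by blast
    next
      case False
      then show ?thesis using uy yN step(2) by (meson DiffI linked_edge linked_trans)
    qed
  qed blast
qed

text \<open>Each passage of the walk through \<open>uv\<close>, in either direction, is replaced by
  the detour.\<close>

lemma linked_remove_edge:
  assumes "linked (insert {u, v} E) D x y" "u \<in> D \<Longrightarrow> v \<in> D \<Longrightarrow> linked E D u v"
  shows "linked E D x y"
  using assms(1) unfolding linked_def[of "insert {u, v} E"]
proof (induction rule: rtranclp_induct)
  case base
  then show ?case by simp
next
  case (step y z)
  have "linked E D y z"
    using step(2) assms(2) linked_edge[of y z E D]
    by (auto simp: doubleton_eq_iff intro: linked_sym)
  with step.IH show ?case by (rule linked_trans)
qed

lemma away_commute: "away E b x y = away E b y x"
  by (auto simp: away_def)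

lemma corner_sym: "corner E x b y \<Longrightarrow> corner E y b x"
  using linked_sym[of E "away E b x y" x y]
  unfolding corner_def away_commute[of E b y x] insert_commute[of y x] by auto

text \<open>The walk in the restricted edge set stays in \<open>S\<close>, and inside
  \<open>S\<close> the two \<open>away\<close> sets agree. Hence holes of an induced subgraph are
  holes of the whole graph.\<close>

lemma corner_restrict:
  assumes "corner (E \<inter> Pow S) x b y"
  shows "corner E x b y"
proof -
  have S: "x \<in> S" "b \<in> S" "y \<in> S" using assms by (auto simp: corner_def)
  have "linked E (away (E \<inter> Pow S) b x y \<inter> S) x y"
    using assms by (auto simp: corner_def intro: linked_restrict)
  moreover have "away (E \<inter> Pow S) b x y \<inter> S \<subseteq> away E b x y"
    using S by (auto simp: away_def)
  ultimately show ?thesis using assms S by (auto simp: corner_def intro: linked_mono)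
qed

subsection \<open>Holes\<close>

text \<open>A shortest walk is an induced path, since a repeated vertex or a chord would shorten it.
  The assumption \<open>x \<in> D\<close> takes care of the walk of length zero, because
  \<open>linked\<close> is reflexive even outside \<open>D\<close>.\<close>

lemma linked_induced_path:
  assumes "linked E D x y" "x \<in> D"
  obtains q m where "q 0 = x" "q m = y" "\<And>i. i \<le> m \<Longrightarrow> q i \<in> D" "inj_on q {..m}"
    "\<And>i j. i < j \<Longrightarrow> j \<le> m \<Longrightarrow> {q i, q j} \<in> E \<longleftrightarrow> j = Suc i"
proof -
  define R where "R = (\<lambda>a b. {a, b} \<in> E \<and> a \<in> D \<and> b \<in> D)"
  have "\<exists>m. (R ^^ m) x y"
    using assms(1) by (simp add: linked_def R_def rtranclp_power)
  define m where "m = (LEAST m. (R ^^ m) x y)"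
  have m: "(R ^^ m) x y" unfolding m_def by (rule LeastI_ex) fact
  have least: "m \<le> k" if "(R ^^ k) x y" for k
    unfolding m_def using that by (rule Least_le)
  obtain q where q: "q 0 = x" "q m = y" "\<And>i. i < m \<Longrightarrow> R (q i) (q (Suc i))"
    using m unfolding relpowp_fun_conv by blast
  have start: "(R ^^ i) x (q i)" if "i \<le> m" for i
    unfolding relpowp_fun_conv using q that by (intro exI[of _ q]) auto
  have fin: "(R ^^ (m - j)) (q j) y" if "j \<le> m" for j
    unfolding relpowp_fun_conv using q that by (intro exI[of _ "\<lambda>k. q (k + j)"]) auto
  have D: "q i \<in> D" if "i \<le> m" for i
    using q(3)[of "i - 1"] q(1) assms(2) that by (cases i) (auto simp: R_def)
  have ne: "q i \<noteq> q j" if "i < j" "j \<le> m" for i j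
  proof
    assume "q i = q j"
    then have "(R ^^ (i + (m - j))) x y"
      using start[of i] fin[of j] that unfolding relpowp_add by auto
    from least[OF this] that show False by simp
  qed
  have adj: "{q i, q j} \<in> E \<longleftrightarrow> j = Suc i" if "i < j" "j \<le> m" for i j
  proof
    assume "{q i, q j} \<in> E"
    then have "R (q i) (q j)" using D that by (simp add: R_def)
    then have "(R ^^ Suc i) x (q j)" using start[of i] that by auto
    then have "(R ^^ (Suc i + (m - j))) x y"
      using fin[of j] that unfolding relpowp_add by blast
    from least[OF this] that show "j = Suc i" by simp
  next
    assume "j = Suc i"
    then show "{q i, q j} \<in> E" using q(3)[of i] that by (simp add: R_def)
  qed
  have "inj_on q {..m}"
    using ne by (intro inj_onI) (metis atMost_iff linorder_neqE_nat)
  then show thesis using that q(1,2) D adj by blast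
qed

lemma Suc_mod_cases: "i < n \<Longrightarrow> Suc i mod n = (if Suc i = n then 0 else Suc i)"
  by auto

lemma holeI:
  assumes "4 \<le> n" "inj_on c {..<n}" "pairs E"
    "\<And>i j. i < j \<Longrightarrow> j < n \<Longrightarrow> {c i, c j} \<in> E \<longleftrightarrow> j = Suc i \<or> i = 0 \<and> Suc j = n"
  shows "hole E n c"
  unfolding hole_def
proof (intro conjI allI impI)
  fix i j assume ij: "i < n" "j < n"
  have *: "{c i, c j} \<in> E \<longleftrightarrow> j = Suc i mod n \<or> i = Suc j mod n" if "i < j" "j < n" for i j
    using assms(4)[OF that] that assms(1) by (auto simp: Suc_mod_cases split: if_splits)
  consider "i < j" | "i = j" | "j < i" by linarith
  then show "{c i, c j} \<in> E \<longleftrightarrow> j = Suc i mod n \<or> i = Suc j mod n"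
  proof cases
    case 2
    then show ?thesis using pairs_irrefl[OF assms(3)] ij assms(1)
      by (auto simp: Suc_mod_cases split: if_splits)
  next
    case 3
    then show ?thesis using *[of j i] ij by (auto simp: insert_commute)
  qed (use * ij in blast)
qed (use assms in auto)

lemma hole_edge_iff:
  assumes "hole E n c" "i < j" "j < n"
  shows "{c i, c j} \<in> E \<longleftrightarrow> j = Suc i \<or> i = 0 \<and> Suc j = n"
proof -
  have "{c i, c j} \<in> E \<longleftrightarrow> j = Suc i mod n \<or> i = Suc j mod n"
    using assms by (simp add: hole_def)
  then show ?thesis using assms by (auto simp: Suc_mod_cases split: if_splits)
qed

lemma hole_neq:
  assumes "hole E n c" "i < n" "j < n" "i \<noteq> j"
  shows "c i \<noteq> c j"
  using assms by (auto simp: hole_def inj_on_def)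

text \<open>Lets any vertex of a hole take the place of \<open>c 0\<close>.\<close>

lemma hole_rotate:
  assumes "hole E n c"
  shows "hole E n (\<lambda>k. c ((k + r) mod n))"
proof -
  have n: "4 \<le> n" and inj: "inj_on c {..<n}"
    and adj: "\<And>i j. i < n \<Longrightarrow> j < n \<Longrightarrow> {c i, c j} \<in> E \<longleftrightarrow> j = Suc i mod n \<or> i = Suc j mod n"
    using assms by (auto simp: hole_def)
  have shift: "(i + r) mod n = (j + r) mod n \<longleftrightarrow> i mod n = j mod n" for i j
    unfolding nat_mod_eq_iff by (simp add: add.assoc add.left_commute[of _ r])
  have succ: "(j + r) mod n = Suc ((i + r) mod n) mod n \<longleftrightarrow> j = Suc i mod n" if "j < n" for i j
    using shift[of j "Suc i"] that by (simp add: mod_Suc_eq)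
  show ?thesis
    unfolding hole_def
  proof (intro conjI allI impI n)
    show "inj_on (\<lambda>k. c ((k + r) mod n)) {..<n}"
    proof (rule inj_onI)
      fix i j assume ij: "i \<in> {..<n}" "j \<in> {..<n}" "c ((i + r) mod n) = c ((j + r) mod n)"
      then have "(i + r) mod n = (j + r) mod n" using n by (auto intro: inj_onD[OF inj])
      then show "i = j" using shift ij by simp
    qed
    fix i j assume "i < n" "j < n"
    then show "{c ((i + r) mod n), c ((j + r) mod n)} \<in> E \<longleftrightarrow> j = Suc i mod n \<or> i = Suc j mod n"
      using adj[of "(i + r) mod n" "(j + r) mod n"] succ by simp
  qed
qed

lemma rotate_image: "(\<lambda>k. c ((k + r) mod n)) ` {..<n} = c ` {..<n::nat}"
proof (cases "n = 0")
  case False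
  have "c i \<in> (\<lambda>k. c ((k + r) mod n)) ` {..<n}" if "i < n" for i
  proof (rule image_eqI)
    \<comment> \<open>Modulo \<open>n\<close>, a shift by \<open>n - r mod n\<close> undoes the
      shift by \<open>r\<close>.\<close>
    have "((i + (n - r mod n)) mod n + r) mod n = (i + (n - r mod n) + r mod n) mod n"
      by (simp add: mod_simps)
    also have "\<dots> = i"
      using that mod_less_divisor[of n r] by (simp del: mod_less_divisor)
    finally show "c i = c (((i + (n - r mod n)) mod n + r) mod n)" by simp
  qed (use False in auto)
  then show ?thesis using False by auto
qed auto

text \<open>A shortest path from \<open>x\<close> to \<open>y\<close> in the \<open>away\<close> set
  is induced, and \<open>b\<close> sees only its two ends, so \<open>b\<close> closes it to an
  induced cycle. As \<open>x\<close> and \<open>y\<close> are distinct and non-adjacent, the path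
  has at least two edges and the cycle at least four vertices.\<close>

lemma corner_hole:
  assumes "pairs E" "corner E x b y"
  obtains n c where "hole E n c" "c 0 = b" "c 1 = x" "c (n - 1) = y"
proof -
  have E: "{b, x} \<in> E" "{b, y} \<in> E" "x \<noteq> y" "{x, y} \<notin> E" "linked E (away E b x y) x y"
    using assms(2) by (auto simp: corner_def)
  have "x \<in> away E b x y" using pairs_neq[OF assms(1) E(1)] by (auto simp: away_def)
  then obtain q m where q: "q 0 = x" "q m = y" "\<And>i. i \<le> m \<Longrightarrow> q i \<in> away E b x y" "inj_on q {..m}"
    "\<And>i j. i < j \<Longrightarrow> j \<le> m \<Longrightarrow> {q i, q j} \<in> E \<longleftrightarrow> j = Suc i"
    using linked_induced_path[OF E(5)] by blast
  have "m \<noteq> 0" using q(1,2) E(3) by metis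
  moreover have "m \<noteq> 1" using q(5)[of 0 1] q(1,2) E(4) by auto
  ultimately have m: "2 \<le> m" by simp
  \<comment> \<open>With \<open>b\<close> put in front of the path, the hole has
    \<open>m + 2\<close> vertices and its last one is \<open>q m = y\<close>.\<close>
  define c where "c = (\<lambda>k. case k of 0 \<Rightarrow> b | Suc k \<Rightarrow> q k)"
  have bq: "{b, q i} \<in> E \<longleftrightarrow> i = 0 \<or> i = m" if "i \<le> m" for i
  proof
    assume "{b, q i} \<in> E"
    then have "q i = q 0 \<or> q i = q m" using q(1-3) that by (auto simp: away_def)
    then show "i = 0 \<or> i = m" using q(4) that by (auto simp: inj_on_def)
  qed (use q E in auto)
  have nb: "b \<noteq> q i" "q i \<noteq> b" if "i < Suc m" for i
    using q(3)[of i] that by (auto simp: away_def)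
  have "hole E (m + 2) c"
  proof (rule holeI)
    show "inj_on c {..<m + 2}"
      using q(3,4) nb by (auto simp: inj_on_def c_def split: nat.splits)
    fix i j assume "i < j" "j < m + 2"
    then show "{c i, c j} \<in> E \<longleftrightarrow> j = Suc i \<or> i = 0 \<and> Suc j = m + 2"
      using q(5)[of "i - 1" "j - 1"] bq[of "j - 1"] by (auto simp: c_def split: nat.splits)
  qed (use m assms in auto)
  then show thesis using that[of "m + 2" c] q(1,2) by (simp add: c_def)
qed

text \<open>A corner at \<open>c 0\<close> only asks for a walk, so it survives any change of the
  edge set that keeps the edges of the hole and adds neither a chord at \<open>c 0\<close> nor the
  pair of its two neighbours; other chords of the hole do no harm.\<close>

lemma hole_corner:
  assumes "hole E n c" "pairs E'" "E \<inter> Pow (c ` {..<n}) \<subseteq> E'"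
    and "{c 1, c (n - 1)} \<notin> E'" "\<And>k. 2 \<le> k \<Longrightarrow> k \<le> n - 2 \<Longrightarrow> {c 0, c k} \<notin> E'"
  shows "corner E' (c 1) (c 0) (c (n - 1))"
proof -
  have n: "4 \<le> n" using assms(1) by (simp add: hole_def)
  have e: "{c i, c j} \<in> E'" if "i < j" "j < n" "j = Suc i \<or> i = 0 \<and> Suc j = n" for i j
    using hole_edge_iff[OF assms(1) that(1,2)] that assms(3) by fastforce
  have "linked E' (away E' (c 0) (c 1) (c (n - 1))) (c 1) (c (n - 1))"
  proof (rule linked_seq)
    fix k assume k: "1 \<le> k" "k \<le> n - 1"
    then have "c k \<noteq> c 0" using hole_neq[OF assms(1), of k 0] n by simp
    moreover have "k = 1 \<or> k = n - 1 \<or> 2 \<le> k \<and> k \<le> n - 2" using k by auto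
    ultimately show "c k \<in> away E' (c 0) (c 1) (c (n - 1))"
      using assms(5) by (auto simp: away_def)
  qed (use n e in auto)
  moreover have "c 1 \<noteq> c (n - 1)" using hole_neq[OF assms(1), of 1 "n - 1"] n by simp
  ultimately show ?thesis using e[of 0 1] e[of 0 "n - 1"] n assms(4) by (auto simp: corner_def)
qed

lemma hole_imp_corner:
  assumes "hole E n c" "pairs E"
  shows "corner E (c 1) (c 0) (c (n - 1))"
proof (rule hole_corner[OF assms])
  have n: "4 \<le> n" using assms(1) by (simp add: hole_def)
  then show "{c 1, c (n - 1)} \<notin> E" using hole_edge_iff[OF assms(1), of 1 "n - 1"] by simp
  show "{c 0, c k} \<notin> E" if "2 \<le> k" "k \<le> n - 2" for k
    using hole_edge_iff[OF assms(1), of 0 k] that n by simp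
qed simp

lemma hole_vertex_corner:
  assumes "hole E n c" "pairs E" "i < n"
  shows "\<exists>x y. corner E x (c i) y"
  using hole_imp_corner[OF hole_rotate[OF assms(1), of i] assms(2)] assms(3) by auto

subsection \<open>Adding an edge\<close>

text \<open>An edge missing \<open>b\<close> leaves the neighbourhood of \<open>b\<close> alone, so
  only the walk from \<open>x\<close> to \<open>y\<close> has to be rerouted. If both ends of the
  new edge lie in the \<open>away\<close> set, they cannot both be neighbours of \<open>b\<close>,
  as they would be \<open>x\<close> and \<open>y\<close>; hence a detour is required only from an
  end \<open>u'\<close> not adjacent to \<open>b\<close>.\<close>

lemma corner_insert_edge:
  assumes "corner (insert {u, v} E) x b y" "b \<noteq> u" "b \<noteq> v" "u \<noteq> v"
    and "\<And>u' v'. {u', v'} = {u, v} \<Longrightarrow> {b, u'} \<notin> E \<Longrightarrow> u' \<in> away E b x y \<Longrightarrow>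
      v' \<in> away E b x y \<Longrightarrow> linked E (away E b x y) u' v'"
  shows "corner E x b y"
proof -
  have b: "{b, w} \<in> insert {u, v} E \<longleftrightarrow> {b, w} \<in> E" for w
    using assms(2,3) by (auto simp: doubleton_eq_iff)
  have aw: "away (insert {u, v} E) b x y = away E b x y"
    unfolding away_def b ..
  have c: "{b, x} \<in> E" "{b, y} \<in> E" "x \<noteq> y" "{x, y} \<notin> E" "{x, y} \<noteq> {u, v}"
    "linked (insert {u, v} E) (away E b x y) x y"
    using assms(1) unfolding corner_def aw b by auto
  have "linked E (away E b x y) u v" if uv: "u \<in> away E b x y" "v \<in> away E b x y"
  proof -
    have "{b, u} \<notin> E \<or> {b, v} \<notin> E"
    proof (rule ccontr)
      assume "\<not> ?thesis"
      then have "u = x \<or> u = y" "v = x \<or> v = y" using uv by (auto simp: away_def)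
      then show False using c(5) assms(4) by auto
    qed
    then show ?thesis
      using assms(5)[of u v] assms(5)[of v u] uv by (auto simp: insert_commute intro: linked_sym)
  qed
  then have "linked E (away E b x y) x y" using c(6) linked_remove_edge by metis
  then show ?thesis using c by (simp add: corner_def)
qed

text \<open>Walk from \<open>u\<close> inside \<open>D\<close> up to the first neighbour of
  \<open>b\<close>. If there is none, or if it is \<open>v\<close>, the walk is a detour in the
  \<open>away\<close> set; otherwise it is the vertex \<open>q\<close>.\<close>

lemma linked_around:
  assumes "linked E D u v" "u \<in> D" "b \<notin> D" "{b, u} \<notin> E" "v \<in> away E b x y"
  shows "linked E (away E b x y) u v \<or>
    (\<exists>q\<in>D. q \<noteq> u \<and> q \<noteq> v \<and> {b, q} \<in> E \<and> linked E (insert q {w. w \<noteq> b \<and> {b, w} \<notin> E}) u q)"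
proof -
  have "u \<notin> {w. {b, w} \<in> E}" using assms(4) by simp
  from linked_first_hit[OF assms(1,2) this] show ?thesis
  proof (elim disjE bexE)
    assume "linked E (D - {w. {b, w} \<in> E}) u v"
    then have "linked E (away E b x y) u v"
      by (rule linked_mono) (use assms(3) in \<open>auto simp: away_def\<close>)
    then show ?thesis ..
  next
    fix q assume q: "q \<in> {w. {b, w} \<in> E} \<inter> D"
      and l: "linked E (insert q (D - {w. {b, w} \<in> E})) u q"
    show ?thesis
    proof (cases "q = v")
      case True
      have "linked E (away E b x y) u v"
        using l unfolding True by (rule linked_mono) (use assms(3,5) in \<open>auto simp: away_def\<close>)
      then show ?thesis ..
    next
      case False
      have "linked E (insert q {w. w \<noteq> b \<and> {b, w} \<notin> E}) u q"
        using l by (rule linked_mono) (use assms(3) in auto)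
      then show ?thesis using q False assms(4) by auto
    qed
  qed
qed

text \<open>Joining the two walks at their common start \<open>u\<close> connects \<open>q1\<close>
  to \<open>q2\<close> through non-neighbours of \<open>b\<close>.\<close>

lemma cornerI:
  assumes "pairs E" "{b, q1} \<in> E" "{b, q2} \<in> E" "q1 \<noteq> q2" "{q1, q2} \<notin> E"
    and "linked E (insert q1 {w. w \<noteq> b \<and> {b, w} \<notin> E}) u q1"
      "linked E (insert q2 {w. w \<noteq> b \<and> {b, w} \<notin> E}) u q2"
  shows "corner E q1 b q2"
proof -
  have ne: "q1 \<noteq> b" "q2 \<noteq> b" using pairs_neq[OF assms(1)] assms(2,3) by auto
  have "linked E (away E b q1 q2) u q1"
    using assms(6) by (rule linked_mono) (use ne in \<open>auto simp: away_def\<close>)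
  moreover have "linked E (away E b q1 q2) u q2"
    using assms(7) by (rule linked_mono) (use ne in \<open>auto simp: away_def\<close>)
  ultimately show ?thesis using assms(2-5) by (auto simp: corner_def intro: linked_trans linked_sym)
qed

text \<open>The sets \<open>D1\<close> and \<open>D2\<close> are the two open arcs into which the chord \<open>uv\<close> cuts its hole. If the
  new hole through \<open>b\<close> cannot be rerouted along either arc, then \<open>b\<close> has a neighbour on both, and
  the first ones met from an end of the chord that is not adjacent to \<open>b\<close> form an old corner
  at \<open>b\<close>.\<close>

lemma chord_creates_no_corner:
  assumes E: "pairs E" and W: "\<And>x b y. corner E x b y \<Longrightarrow> b \<in> W"
    and sub: "insert u (insert v (D1 \<union> D2)) \<subseteq> W" and uv: "u \<noteq> v"
    and D: "linked E (insert u (insert v D1)) u v" "linked E (insert u (insert v D2)) u v"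
      "\<And>s t. s \<in> D1 \<Longrightarrow> t \<in> D2 \<Longrightarrow> s \<noteq> t \<and> {s, t} \<notin> E"
    and c: "corner (insert {u, v} E) x b y"
  shows "b \<in> W"
proof (rule ccontr)
  assume b: "b \<notin> W"
  \<comment> \<open>For \<open>b\<close> outside \<open>W\<close> the corner would already exist in
    \<open>E\<close>, contrary to the choice of \<open>W\<close>.\<close>
  have "corner E x b y"
  proof (rule corner_insert_edge[OF c])
    fix u' v' assume e: "{u', v'} = {u, v}" and bu: "{b, u'} \<notin> E" and v': "v' \<in> away E b x y"
    show "linked E (away E b x y) u' v'"
    proof (rule ccontr)
      assume no: "\<not> linked E (away E b x y) u' v'"
      \<comment> \<open>Here \<open>D\<close> is either arc. It lies in \<open>W\<close> and so
        avoids \<open>b\<close>; since no detour exists, the walk along it must meet a neighbour of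
        \<open>b\<close> strictly inside the arc.\<close>
      have hit: "\<exists>q\<in>D. {b, q} \<in> E \<and> linked E (insert q {w. w \<noteq> b \<and> {b, w} \<notin> E}) u' q"
        if l: "linked E (insert u (insert v D)) u v" and DW: "D \<subseteq> W" for D
      proof -
        have "linked E (insert u' (insert v' D)) u' v'"
          using l e linked_sym[OF l] by (auto simp: doubleton_eq_iff insert_commute)
        then show ?thesis
          using linked_around[of E "insert u' (insert v' D)" u' v' b x y] no bu v' b DW sub e
          by (auto simp: doubleton_eq_iff)
      qed
      obtain q1 q2 where "q1 \<in> D1" "{b, q1} \<in> E" "q2 \<in> D2" "{b, q2} \<in> E"
        "linked E (insert q1 {w. w \<noteq> b \<and> {b, w} \<notin> E}) u' q1"
        "linked E (insert q2 {w. w \<noteq> b \<and> {b, w} \<notin> E}) u' q2"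
        using hit[OF D(1)] hit[OF D(2)] sub by auto
      \<comment> \<open>Lying on different arcs, \<open>q1\<close> and \<open>q2\<close> are
        distinct and non-adjacent.\<close>
      then have "corner E q1 b q2" using D(3) by (intro cornerI[OF E]) auto
      then show False using W b by blast
    qed
  qed (use b sub uv in auto)
  then show False using W b by blast
qed

text \<open>The path \<open>u, b0, v\<close> replaces the new edge unless \<open>b\<close> is adjacent to \<open>b0\<close>; in that case the rest
  of the hole through \<open>b0\<close> does, since otherwise \<open>b0\<close> would be a neighbour of \<open>b\<close> on a hole with
  both outside \<open>U\<close>.\<close>

lemma essential_edge_creates_no_corner:
  assumes E: "pairs E" and U: "\<And>x b y. corner E x b y \<Longrightarrow> b \<notin> U \<Longrightarrow> x \<in> U"
    and uv: "u \<in> U" "v \<in> U" "b0 \<notin> U" "corner E u b0 v"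
    and c: "corner (insert {u, v} E) x b y" and b: "b \<notin> U"
  shows "corner E x b y"
proof (rule corner_insert_edge[OF c])
  fix u' v' assume e: "{u', v'} = {u, v}" and bu: "{b, u'} \<notin> E"
    and u': "u' \<in> away E b x y" and v': "v' \<in> away E b x y"
  have c0: "corner E u' b0 v'" using uv(4) e by (auto simp: doubleton_eq_iff intro: corner_sym)
  have u'U: "u' \<in> U" "v' \<in> U" using e uv by (auto simp: doubleton_eq_iff)
  have ne: "b \<noteq> b0" using c0 bu by (auto simp: corner_def)
  show "linked E (away E b x y) u' v'"
  proof (cases "{b, b0} \<in> E")
    case False
    then have "b0 \<in> away E b x y" using ne by (auto simp: away_def)
    then have "linked E (away E b x y) u' b0" "linked E (away E b x y) b0 v'"
      using c0 u' v' by (auto simp: corner_def insert_commute intro!: linked_edge)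
    then show ?thesis by (rule linked_trans)
  next
    case True
    show ?thesis
    proof (rule ccontr)
      assume no: "\<not> linked E (away E b x y) u' v'"
      have "b0 \<noteq> u'" using u'U uv(3) by auto
      then have "u' \<in> away E b0 u' v'" by (simp add: away_def)
      \<comment> \<open>The rest of the hole through \<open>b0\<close> avoids \<open>b\<close>,
        because \<open>b\<close> is a neighbour of \<open>b0\<close> other than \<open>u'\<close>
        and \<open>v'\<close>. It is thus a second candidate for the detour.\<close>
      moreover have "b \<notin> away E b0 u' v'"
        using True u'U b by (auto simp: away_def insert_commute)
      ultimately obtain q where q: "q \<in> away E b0 u' v'" "q \<noteq> u'" "q \<noteq> v'" "{b, q} \<in> E"
        "linked E (insert q {w. w \<noteq> b \<and> {b, w} \<notin> E}) u' q"
        using linked_around[of E "away E b0 u' v'" u' v' b x y] no bu v' c0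
        by (auto simp: corner_def)
      have "linked E (insert b0 {w. w \<noteq> b \<and> {b, w} \<notin> E}) u' b0"
        using c0 bu b u'U by (intro linked_edge) (auto simp: corner_def insert_commute)
      then have "corner E b0 b q"
        using q True by (intro cornerI[OF E]) (auto simp: away_def)
      then show False using U b uv(3) by blast
    qed
  qed
qed (use uv b in \<open>auto simp: corner_def\<close>)

text \<open>Supplies the arcs \<open>D1\<close> and \<open>D2\<close> of
  \<open>chord_creates_no_corner\<close> for a prospective chord from \<open>c 0\<close> to
  \<open>c k\<close>.\<close>

lemma hole_chord_sides:
  assumes h: "hole E n c" and k: "2 \<le> k" "k \<le> n - 2"
  shows "linked E (insert (c 0) (insert (c k) (c ` {1..<k}))) (c 0) (c k)"
    and "linked E (insert (c 0) (insert (c k) (c ` {k<..<n}))) (c 0) (c k)"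
    and "s \<in> c ` {1..<k} \<Longrightarrow> t \<in> c ` {k<..<n} \<Longrightarrow> s \<noteq> t \<and> {s, t} \<notin> E"
proof -
  have n: "4 \<le> n" using h by (simp add: hole_def)
  note e = hole_edge_iff[OF h]
  show "linked E (insert (c 0) (insert (c k) (c ` {1..<k}))) (c 0) (c k)"
  proof (rule linked_seq)
    fix j assume "0 \<le> j" "j \<le> k"
    then have "j = 0 \<or> j = k \<or> j \<in> {1..<k}" by auto
    then show "c j \<in> insert (c 0) (insert (c k) (c ` {1..<k}))" by auto
  qed (use k e in auto)
  \<comment> \<open>The far arc runs from \<open>c k\<close> up to \<open>c (n - 1)\<close> and
    closes with the edge back to \<open>c 0\<close>.\<close>
  have "linked E (insert (c 0) (insert (c k) (c ` {k<..<n}))) (c k) (c (n - 1))"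
  proof (rule linked_seq)
    fix j assume "k \<le> j" "j \<le> n - 1"
    then have "j = k \<or> j \<in> {k<..<n}" using n by auto
    then show "c j \<in> insert (c 0) (insert (c k) (c ` {k<..<n}))" by auto
  qed (use k e in auto)
  moreover have "{c 0, c (n - 1)} \<in> E" using e[of 0 "n - 1"] n by simp
  then have "linked E (insert (c 0) (insert (c k) (c ` {k<..<n}))) (c 0) (c (n - 1))"
    by (rule linked_edge) (use k n in auto)
  ultimately show "linked E (insert (c 0) (insert (c k) (c ` {k<..<n}))) (c 0) (c k)"
    by (meson linked_sym linked_trans)
  assume "s \<in> c ` {1..<k}" "t \<in> c ` {k<..<n}"
  then obtain i j where ij: "s = c i" "t = c j" "1 \<le> i" "i < k" "k < j" "j < n" by auto
  then show "s \<noteq> t \<and> {s, t} \<notin> E" using e[of i j] hole_neq[OF h, of i j] by simp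
qed

section \<open>Completing a fill of an induced subgraph when all corner centres lie inside
  it\<close>

lemma maximal_subset:
  assumes "finite F" "P {}"
  obtains M where "M \<subseteq> F" "P M" "\<And>e. e \<in> F \<Longrightarrow> P (insert e M) \<Longrightarrow> e \<in> M"
proof -
  have "finite {M \<in> Pow F. P M}" "{M \<in> Pow F. P M} \<noteq> {}" using assms by auto
  from finite_has_maximal[OF this] obtain M
    where M: "M \<subseteq> F" "P M" and max: "\<forall>X\<in>{M \<in> Pow F. P M}. M \<subseteq> X \<longrightarrow> M = X"
    by auto
  have "e \<in> M" if "e \<in> F" "P (insert e M)" for e
    using bspec[OF max, of "insert e M"] that M(1) by auto
  with M show thesis by (rule that)
qed

text \<open>Choose \<open>M\<close> maximal in \<open>F\<close> such that all corner centres stay in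
  \<open>W\<close>. A hole left in \<open>E \<union> M\<close> then lies in \<open>W\<close>, and
  \<open>F\<close> contains no chord of it: adding one would create no centre outside
  \<open>W\<close>, so by maximality it would already be in \<open>M\<close>. The hole therefore
  yields a corner in \<open>E \<inter> Pow W \<union> F\<close>, which has none.\<close>

lemma completion_extends:
  assumes E: "pairs E" and F: "pairs F" "finite F" and W: "\<And>x b y. corner E x b y \<Longrightarrow> b \<in> W"
    and ch: "\<And>x b y. \<not> corner (E \<inter> Pow W \<union> F) x b y"
  shows "\<exists>F'\<subseteq>F. \<forall>x b y. \<not> corner (E \<union> F') x b y"
proof -
  define P where "P F' \<longleftrightarrow> (\<forall>x b y. corner (E \<union> F') x b y \<longrightarrow> b \<in> W)" for F'
  have "P {}" using W by (simp add: P_def)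
  then obtain M where M: "M \<subseteq> F" "P M" and max: "\<And>e. e \<in> F \<Longrightarrow> P (insert e M) \<Longrightarrow> e \<in> M"
    using maximal_subset[OF F(2)] by metis
  have MW: "b \<in> W" if "corner (E \<union> M) x b y" for x b y
    using M(2) that unfolding P_def by blast
  have EM: "pairs (E \<union> M)" using E F M by (auto simp: pairs_def)
  have no_chord: "{c 0, c k} \<notin> F" if h: "hole (E \<union> M) n c" and k: "2 \<le> k" "k \<le> n - 2" for c n k
  proof
    assume f: "{c 0, c k} \<in> F"
    have n: "4 \<le> n" using h by (simp add: hole_def)
    have cW: "c i \<in> W" if "i < n" for i
      using hole_vertex_corner[OF h EM that] MW by blast
    have "P (insert {c 0, c k} M)"
      unfolding P_def
    proof (intro allI impI)
      fix x b y assume "corner (E \<union> insert {c 0, c k} M) x b y"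
      then have co: "corner (insert {c 0, c k} (E \<union> M)) x b y" by simp
      have ne: "c 0 \<noteq> c k" using hole_neq[OF h, of 0 k] k n by simp
      have sub: "insert (c 0) (insert (c k) (c ` {1..<k} \<union> c ` {k<..<n})) \<subseteq> W"
        using cW k n by auto
      show "b \<in> W"
        by (rule chord_creates_no_corner[OF EM _ sub ne hole_chord_sides[OF h k] co]) (rule MW)
    qed
    then have "{c 0, c k} \<in> M" by (rule max[OF f])
    moreover have "k < n" "Suc k \<noteq> n" using k n by auto
    ultimately show False using hole_edge_iff[OF h, of 0 k] k by auto
  qed
  have False if co: "corner (E \<union> M) x b y" for x b y
  proof -
    obtain n c where h: "hole (E \<union> M) n c" by (rule corner_hole[OF EM co])
    have n: "4 \<le> n" using h by (simp add: hole_def)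
    have cW: "c i \<in> W" if "i < n" for i
      using hole_vertex_corner[OF h EM that] MW by blast
    have nonF: "{c 0, c k} \<notin> E \<inter> Pow W \<union> F" if "2 \<le> k" "k \<le> n - 2" for k
    proof -
      have "k < n" "Suc k \<noteq> n" using that n by auto
      then show ?thesis using no_chord[OF h that] hole_edge_iff[OF h, of 0 k] that by auto
    qed
    \<comment> \<open>Rotating by \<open>n - 1\<close> turns the pair of neighbours of
      \<open>c 0\<close> into the pair with indices 0 and 2, which \<open>no_chord\<close>
      covers.\<close>
    define c' where "c' = (\<lambda>k. c ((k + (n - 1)) mod n))"
    have h': "hole (E \<union> M) n c'" unfolding c'_def by (rule hole_rotate[OF h])
    have "c' 0 = c (n - 1)" "c' 2 = c 1"
      using n by (auto simp: c'_def mod_if)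
    then have "{c 1, c (n - 1)} \<notin> F" "{c 1, c (n - 1)} \<notin> E"
      using no_chord[OF h', of 2] n hole_edge_iff[OF h', of 0 2] by (auto simp: insert_commute)
    then have nonF1: "{c 1, c (n - 1)} \<notin> E \<inter> Pow W \<union> F" by simp
    have "pairs (E \<inter> Pow W \<union> F)" using E F(1) by (auto simp: pairs_def)
    moreover have "(E \<union> M) \<inter> Pow (c ` {..<n}) \<subseteq> E \<inter> Pow W \<union> F" using M(1) cW by auto
    ultimately have "corner (E \<inter> Pow W \<union> F) (c 1) (c 0) (c (n - 1))"
      using nonF1 nonF by (rule hole_corner[OF h])
    with ch show False by (rule notE)
  qed
  then show ?thesis using M(1) by blast
qed

subsection \<open>Fills and the kernel\<close>

text \<open>A fill may overlap \<open>E\<close>; the common edges are discarded only in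
  \<open>edge_add_chordal_iff\<close>.\<close>

definition fills :: "'a set set \<Rightarrow> 'a set \<Rightarrow> 'a set set \<Rightarrow> bool" where
  "fills E S F \<longleftrightarrow> pairs F \<and> finite F \<and> F \<subseteq> Pow S \<and> (\<forall>x b y. \<not> corner (E \<inter> Pow S \<union> F) x b y)"

lemma fills_restrict:
  assumes "fills E S F" "T \<subseteq> S"
  shows "fills E T (F \<inter> Pow T)"
proof -
  have "E \<inter> Pow T \<union> F \<inter> Pow T = (E \<inter> Pow S \<union> F) \<inter> Pow T" using assms(2) by auto
  then show ?thesis
    using assms corner_restrict[of "E \<inter> Pow S \<union> F" T] by (auto simp: fills_def pairs_def)
qed

text \<open>Otherwise \<open>hole_corner\<close> would leave a corner at \<open>c 0\<close> in the
  filled graph, whatever the fill does to the rest of the hole.\<close>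

lemma fills_hole:
  assumes "pairs E" "hole E n c" "c ` {..<n} \<subseteq> S" "fills E S F"
  shows "{c 1, c (n - 1)} \<in> F \<or> (\<exists>e\<in>F. c 0 \<in> e)"
proof (rule ccontr)
  assume no: "\<not> ?thesis"
  have n: "4 \<le> n" using assms(2) by (simp add: hole_def)
  have "{c 1, c (n - 1)} \<notin> E"
    using hole_edge_iff[OF assms(2), of 1 "n - 1"] n by simp
  moreover have "{c 0, c k} \<notin> E" if "2 \<le> k" "k \<le> n - 2" for k
    using hole_edge_iff[OF assms(2), of 0 k] that n by simp
  ultimately have "corner (E \<inter> Pow S \<union> F) (c 1) (c 0) (c (n - 1))"
    by (intro hole_corner[OF assms(2)]) (use assms no in \<open>auto simp: fills_def pairs_def\<close>)
  then show False using assms(4) by (auto simp: fills_def)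
qed

lemma card_Union_pairs:
  assumes "pairs F"
  shows "card (\<Union>F) \<le> 2 * card F"
proof -
  have "card (\<Union>F) \<le> sum card F" by (rule card_Union_le_sum_card)
  also have "\<dots> = 2 * card F" using assms by (simp add: pairs_def)
  finally show ?thesis .
qed

text \<open>By \<open>fills_hole\<close> for every rotation, of any two consecutive vertices at
  least one is an end of a fill edge. So \<open>I\<close> and \<open>J\<close> cover all indices,
  and each has at most \<open>2 * card F\<close> elements.\<close>

lemma hole_length_le:
  assumes E: "pairs E" and h: "hole E n c" and F: "fills E (c ` {..<n}) F"
  shows "n \<le> 4 * card F"
proof -
  have n: "4 \<le> n" and inj: "inj_on c {..<n}" using h by (auto simp: hole_def)
  have fin: "finite (\<Union>F)"
    by (rule finite_subset[of _ "c ` {..<n}"]) (use F in \<open>auto simp: fills_def\<close>)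
  define I where "I = {i\<in>{..<n}. c i \<in> \<Union>F}"
  define J where "J = {i\<in>{..<n}. c (Suc i mod n) \<in> \<Union>F}"
  have sucinj: "inj_on (\<lambda>i. Suc i mod n) {..<n}"
    by (intro inj_onI) (auto simp: Suc_mod_cases split: if_splits)
  have "card I \<le> card (\<Union>F)"
    by (rule card_inj_on_le[of c]) (auto intro: inj_on_subset[OF inj] fin simp: I_def)
  moreover have "card J \<le> card (\<Union>F)"
  proof (rule card_inj_on_le[of "\<lambda>i. c (Suc i mod n)"])
    show "inj_on (\<lambda>i. c (Suc i mod n)) J"
    proof (rule inj_onI)
      fix i j assume ij: "i \<in> J" "j \<in> J" "c (Suc i mod n) = c (Suc j mod n)"
      have "Suc i mod n = Suc j mod n" by (rule inj_onD[OF inj ij(3)]) (use n in auto)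
      then show "i = j" by (rule inj_onD[OF sucinj]) (use ij in \<open>auto simp: J_def\<close>)
    qed
  qed (use fin in \<open>auto simp: J_def\<close>)
  moreover have "{..<n} \<subseteq> I \<union> J"
  proof
    fix i assume i: "i \<in> {..<n}"
    have "hole E n (\<lambda>k. c ((k + i) mod n))" by (rule hole_rotate[OF h])
    from fills_hole[OF E this _ F] rotate_image[of c i n]
    have "(\<exists>e\<in>F. c (Suc i mod n) \<in> e) \<or> (\<exists>e\<in>F. c (i mod n) \<in> e)" by auto
    then show "i \<in> I \<union> J" using i by (auto simp: I_def J_def)
  qed
  then have "n \<le> card (I \<union> J)"
    using card_mono[of "I \<union> J" "{..<n}"] by (simp add: I_def J_def)
  moreover have "card (I \<union> J) \<le> card I + card J" by (rule card_Un_le)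
  moreover have "card (\<Union>F) \<le> 2 * card F" using F by (intro card_Union_pairs) (simp add: fills_def)
  ultimately show ?thesis by linarith
qed

text \<open>A fill without \<open>uv\<close> would have an edge at every vertex of \<open>T\<close>,
  but its edges have at most \<open>2 * card F\<close> ends.\<close>

lemma essential_pair:
  assumes E: "pairs E" and F: "fills E S F" and T: "2 * card F < card T"
    and h: "\<And>b. b \<in> T \<Longrightarrow>
      \<exists>n c. hole E n c \<and> c 0 = b \<and> c 1 = u \<and> c (n - 1) = v \<and> c ` {..<n} \<subseteq> S"
    and S: "finite S"
  shows "{u, v} \<in> F"
proof (rule ccontr)
  assume no: "{u, v} \<notin> F"
  have "b \<in> \<Union>F" if b: "b \<in> T" for b
  proof -
    obtain n c where c: "hole E n c" "c 0 = b" "c 1 = u" "c (n - 1) = v" "c ` {..<n} \<subseteq> S"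
      using h[OF b] by auto
    from fills_hole[OF E c(1,5) F] show ?thesis using no unfolding c(2-4) by auto
  qed
  then have "T \<subseteq> \<Union>F" by (rule subsetI)
  moreover have "finite (\<Union>F)"
    by (rule finite_subset[of _ S]) (use F S in \<open>auto simp: fills_def\<close>)
  ultimately have "card T \<le> card (\<Union>F)" by (intro card_mono)
  also have "\<dots> \<le> 2 * card F" using F by (intro card_Union_pairs) (simp add: fills_def)
  finally show False using T by simp
qed

section \<open>Construction of the kernel\<close>

lemma hole_vertices:
  assumes "pairs E" "E \<subseteq> Pow V" "hole E n c"
  shows "c ` {..<n} \<subseteq> V"
proof safe
  fix i assume "i < n"
  then obtain x y where "corner E x (c i) y"
    using hole_vertex_corner[OF assms(3,1)] by blast
  then have "{c i, x} \<in> E" by (simp add: corner_def)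
  then show "c i \<in> V" using assms(2) by auto
qed

text \<open>If a corner has both \<open>b\<close> and its neighbour \<open>x\<close> outside
  \<open>U\<close>, its hole is added to \<open>U\<close>. By \<open>fills_hole\<close> a fill of
  the larger set has an edge at \<open>b\<close> or at \<open>x\<close>, hence not inside
  \<open>U\<close>, while its edges inside \<open>U\<close> already fill \<open>U\<close>; so the
  lower bound grows by one.\<close>

lemma corners_outside_or_many_fills:
  assumes E: "pairs E" "E \<subseteq> Pow V" and hl: "\<And>n c. hole E n c \<Longrightarrow> n \<le> l"
  shows "\<exists>U\<subseteq>V. card U \<le> k * l \<and> ((\<forall>x b y. corner E x b y \<longrightarrow> b \<notin> U \<longrightarrow> x \<in> U) \<or>
    (\<forall>F. fills E U F \<longrightarrow> k \<le> card F))"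
proof (induction k)
  case 0
  show ?case by (rule exI[of _ "{}"]) simp
next
  case (Suc k)
  then obtain U where U: "U \<subseteq> V" "card U \<le> k * l"
    and alt: "(\<forall>x b y. corner E x b y \<longrightarrow> b \<notin> U \<longrightarrow> x \<in> U) \<or> (\<forall>F. fills E U F \<longrightarrow> k \<le> card F)"
    by blast
  show ?case
  proof (cases "\<forall>x b y. corner E x b y \<longrightarrow> b \<notin> U \<longrightarrow> x \<in> U")
    case True
    then show ?thesis using U by (intro exI[of _ U]) auto
  next
    case False
    then obtain x b y where c: "corner E x b y" "b \<notin> U" "x \<notin> U" by blast
    obtain n c where h: "hole E n c" "c 0 = b" "c 1 = x" using corner_hole[OF E(1) c(1)] by metis
    let ?U = "U \<union> c ` {..<n}"
    have "card ?U \<le> card U + card (c ` {..<n})" by (rule card_Un_le)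
    also have "card (c ` {..<n}) \<le> l" using hl[OF h(1)] card_image_le[of "{..<n}" c] by simp
    finally have "card ?U \<le> Suc k * l" using U(2) by simp
    moreover have UV: "?U \<subseteq> V" using U(1) hole_vertices[OF E h(1)] by auto
    moreover have "Suc k \<le> card F" if F: "fills E ?U F" for F
    proof -
      have "k \<le> card (F \<inter> Pow U)" using alt False fills_restrict[OF F, of U] by blast
      moreover have "{x, c (n - 1)} \<in> F \<or> (\<exists>e\<in>F. b \<in> e)"
        using fills_hole[OF E(1) h(1) _ F] h(2,3) by simp
      then have "\<exists>e\<in>F. \<not> e \<subseteq> U" using c(2,3) by blast
      then have "F \<inter> Pow U \<subset> F" by blast
      then have "card (F \<inter> Pow U) < card F" using F by (intro psubset_card_mono) (auto simp: fills_def)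
      ultimately show ?thesis by simp
    qed
    ultimately show ?thesis by blast
  qed
qed

text \<open>\<open>X\<close> collects one hole for each centre in \<open>T\<close>, where
  \<open>T\<close> consists of all centres between \<open>u\<close> and \<open>v\<close> if there
  are at most \<open>2 * p + 1\<close>, and of exactly that many otherwise. In the first case
  \<open>X\<close> contains every centre; in the second \<open>essential_pair\<close> forces
  \<open>uv\<close>.\<close>

lemma essential_witnesses:
  assumes E: "pairs E" "E \<subseteq> Pow V" and V: "finite V" and hl: "\<And>n c. hole E n c \<Longrightarrow> n \<le> l"
  shows "\<exists>X\<subseteq>V. card X \<le> Suc (2 * p) * l \<and> (\<forall>S F. finite S \<longrightarrow> X \<subseteq> S \<longrightarrow> fills E S F \<longrightarrow>
    card F \<le> p \<longrightarrow> {u, v} \<in> F \<or> (\<forall>b. corner E u b v \<longrightarrow> b \<in> X))"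
proof -
  define A where "A = {b. corner E u b v}"
  have "\<exists>T\<subseteq>A. card T \<le> Suc (2 * p) \<and> (T = A \<or> card T = Suc (2 * p))"
  proof (cases "card A \<le> Suc (2 * p)")
    case False
    then obtain T where "T \<subseteq> A" "card T = Suc (2 * p)"
      by (metis obtain_subset_with_card_n nat_le_linear)
    then show ?thesis by (intro exI[of _ T]) simp
  next
    case True
    then show ?thesis by (intro exI[of _ A]) simp
  qed
  then obtain T where T: "T \<subseteq> A" "card T \<le> Suc (2 * p)" "T = A \<or> card T = Suc (2 * p)"
    by (elim exE conjE)
  have "A \<subseteq> V" using E(2) by (auto simp: A_def corner_def)
  then have finT: "finite T" using T(1) V by (meson finite_subset)
  have "\<exists>H n c. hole E n c \<and> c 0 = b \<and> c 1 = u \<and> c (n - 1) = v \<and> c ` {..<n} = H"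
    if b: "b \<in> T" for b
  proof -
    have co: "corner E u b v" using b T(1) by (auto simp: A_def)
    obtain n c where "hole E n c" "c 0 = b" "c 1 = u" "c (n - 1) = v"
      by (rule corner_hole[OF E(1) co])
    then show ?thesis by blast
  qed
  then have "\<forall>b\<in>T. \<exists>H n c. hole E n c \<and> c 0 = b \<and> c 1 = u \<and> c (n - 1) = v \<and> c ` {..<n} = H"
    by (rule ballI)
  from bchoice[OF this] obtain H where H0:
    "\<forall>b\<in>T. \<exists>n c. hole E n c \<and> c 0 = b \<and> c 1 = u \<and> c (n - 1) = v \<and> c ` {..<n} = H b" ..
  note H = bspec[OF H0]
  have HV: "H b \<subseteq> V" and Hl: "card (H b) \<le> l" and bH: "b \<in> H b" if b: "b \<in> T" for b
  proof -
    obtain n c where h: "hole E n c" "c 0 = b" "c ` {..<n} = H b" using H[OF b] by (elim exE conjE)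
    show "H b \<subseteq> V" using hole_vertices[OF E h(1)] h(3) by simp
    show "card (H b) \<le> l"
      using card_image_le[of "{..<n}" c] hl[OF h(1)] h(3) by simp
    have "0 \<in> {..<n}" using h(1) by (simp add: hole_def)
    then show "b \<in> H b" using h(2,3) by blast
  qed
  have "card (\<Union>b\<in>T. H b) \<le> (\<Sum>b\<in>T. card (H b))" by (rule card_UN_le[OF finT])
  also have "\<dots> \<le> card T * l" using sum_bounded_above[of T "\<lambda>b. card (H b)" l] Hl by simp
  also have "\<dots> \<le> Suc (2 * p) * l" by (rule mult_le_mono1[OF T(2)])
  finally have cardX: "card (\<Union>b\<in>T. H b) \<le> Suc (2 * p) * l" .
  have "{u, v} \<in> F \<or> (\<forall>b. corner E u b v \<longrightarrow> b \<in> (\<Union>b\<in>T. H b))"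
    if S: "finite S" "(\<Union>b\<in>T. H b) \<subseteq> S" and F: "fills E S F" "card F \<le> p" for S F
    using T(3)
  proof
    assume "T = A"
    then show ?thesis using bH by (auto simp: A_def)
  next
    assume "card T = Suc (2 * p)"
    then have "2 * card F < card T" using F(2) by simp
    moreover have "\<exists>n c. hole E n c \<and> c 0 = b \<and> c 1 = u \<and> c (n - 1) = v \<and> c ` {..<n} \<subseteq> S"
      if b: "b \<in> T" for b
    proof -
      have "H b \<subseteq> S" using S(2) b by blast
      with H[OF b] show ?thesis by metis
    qed
    ultimately have "{u, v} \<in> F" using S(1) by (rule essential_pair[OF E(1) F(1)])
    then show ?thesis ..
  qed
  with cardX HV show ?thesis by (intro exI[of _ "\<Union>b\<in>T. H b"]) blast
qed

text \<open>\<open>S\<close> is the union of \<open>U\<close> and one witness set for each ordered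
  pair from \<open>U\<close>, which explains the factor \<open>card U * card U\<close>.\<close>

lemma kernel_exists:
  assumes E: "pairs E" "E \<subseteq> Pow V" and V: "finite V" and hl: "\<And>n c. hole E n c \<Longrightarrow> n \<le> l"
    and U: "U \<subseteq> V"
  shows "\<exists>S\<subseteq>V. U \<subseteq> S \<and> card S \<le> card U + card U * card U * (Suc (2 * p) * l) \<and>
    (\<forall>F. fills E S F \<longrightarrow> card F \<le> p \<longrightarrow>
      (\<forall>x\<in>U. \<forall>y\<in>U. \<forall>b. corner E x b y \<longrightarrow> b \<notin> S \<longrightarrow> {x, y} \<in> F))"
proof -
  define good where "good = (\<lambda>e X. X \<subseteq> V \<and> card X \<le> Suc (2 * p) * l \<and>
    (\<forall>S F. finite S \<longrightarrow> X \<subseteq> S \<longrightarrow> fills E S F \<longrightarrow> card F \<le> p \<longrightarrow>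
      {fst e, snd e} \<in> F \<or> (\<forall>b. corner E (fst e) b (snd e) \<longrightarrow> b \<in> X)))"
  have "\<exists>X. good e X" for e
    unfolding good_def by (rule essential_witnesses[OF E V hl])
  then have "\<forall>e. \<exists>X. good e X" by (rule allI)
  from choice[OF this] obtain X where X: "\<forall>e. good e (X e)" ..
  have XV: "X e \<subseteq> V" and Xl: "card (X e) \<le> Suc (2 * p) * l"
    and Xw: "\<And>S F. finite S \<Longrightarrow> X e \<subseteq> S \<Longrightarrow> fills E S F \<Longrightarrow> card F \<le> p \<Longrightarrow>
      {fst e, snd e} \<in> F \<or> (\<forall>b. corner E (fst e) b (snd e) \<longrightarrow> b \<in> X e)" for e
    using X[THEN spec, of e] unfolding good_def by simp_all
  have finU: "finite U" using U V by (rule finite_subset)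
  define S where "S = U \<union> (\<Union>e\<in>U \<times> U. X e)"
  have "card S \<le> card U + card (\<Union>e\<in>U \<times> U. X e)"
    unfolding S_def by (rule card_Un_le)
  also have "card (\<Union>e\<in>U \<times> U. X e) \<le> (\<Sum>e\<in>U \<times> U. card (X e))"
    using card_UN_le[of "U \<times> U" X] finU by simp
  also have "\<dots> \<le> card (U \<times> U) * (Suc (2 * p) * l)"
    using sum_bounded_above[of "U \<times> U" "\<lambda>e. card (X e)"] Xl by simp
  finally have cardS: "card S \<le> card U + card U * card U * (Suc (2 * p) * l)"
    by (simp add: card_cartesian_product)
  have SV: "S \<subseteq> V" unfolding S_def using U XV by (intro Un_least UN_least)
  then have finS: "finite S" using V by (rule finite_subset)
  have XS: "X (x, y) \<subseteq> S" if "x \<in> U" "y \<in> U" for x y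
    using that by (auto simp: S_def)
  have "{x, y} \<in> F" if F: "fills E S F" "card F \<le> p" and xy: "x \<in> U" "y \<in> U"
    and co: "corner E x b y" "b \<notin> S" for F x y b
    using Xw[OF finS XS[OF xy] F] XS[OF xy] co by auto
  with SV cardS show ?thesis by (intro exI[of _ S]) (simp add: S_def)
qed

text \<open>Choose \<open>M\<close> maximal in \<open>F\<close> such that no new corner arises with
  centre outside \<open>U\<close>. A corner with centre outside \<open>S\<close> is then an old one
  whose neighbours \<open>x\<close>, \<open>y\<close> lie in \<open>U\<close>, so \<open>xy\<close>
  is in \<open>F\<close>; adding it is harmless, so it belongs to \<open>M\<close>, although
  \<open>x\<close> and \<open>y\<close> are non-adjacent. Hence all centres lie in \<open>S\<close>,
  and \<open>completion_extends\<close> applies.\<close>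

lemma fills_kernel:
  assumes E: "pairs E" "E \<subseteq> Pow V" and S: "S \<subseteq> V" "U \<subseteq> S" and F: "fills E S F"
    and U: "\<And>x b y. corner E x b y \<Longrightarrow> b \<notin> U \<Longrightarrow> x \<in> U"
    and ess: "\<And>x b y. corner E x b y \<Longrightarrow> x \<in> U \<Longrightarrow> y \<in> U \<Longrightarrow> b \<notin> S \<Longrightarrow> {x, y} \<in> F"
  shows "\<exists>F'\<subseteq>F. fills E V F'"
proof -
  have F': "pairs F" "finite F" "F \<subseteq> Pow S" using F by (auto simp: fills_def)
  define Q where "Q M \<longleftrightarrow> (\<forall>x b y. b \<notin> U \<longrightarrow> corner (E \<union> M) x b y \<longrightarrow> corner E x b y)" for M
  have "Q {}" by (simp add: Q_def)
  then obtain M where M: "M \<subseteq> F" "Q M" and max: "\<And>e. e \<in> F \<Longrightarrow> Q (insert e M) \<Longrightarrow> e \<in> M"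
    using maximal_subset[OF F'(2)] by metis
  have EM: "pairs (E \<union> M)" using E F' M by (auto simp: pairs_def)
  have centre: "b \<in> S" if co: "corner (E \<union> M) x b y" for x b y
  proof (rule ccontr)
    assume bS: "b \<notin> S"
    then have b: "b \<notin> U" using S(2) by blast
    then have coE: "corner E x b y" using M(2) co by (auto simp: Q_def)
    have xy: "x \<in> U" "y \<in> U"
      using U[OF coE b] U[OF corner_sym[OF coE] b] by simp_all
    have e: "{x, y} \<in> F" by (rule ess[OF coE xy bS])
    have UM: "x' \<in> U" if "corner (E \<union> M) x' b' y'" "b' \<notin> U" for x' b' y'
      using U[of x' b' y'] M(2) that unfolding Q_def by simp
    have "Q (insert {x, y} M)"
      unfolding Q_def
    proof (intro allI impI)
      fix x' b' y' assume b': "b' \<notin> U" and "corner (E \<union> insert {x, y} M) x' b' y'"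
      then have c': "corner (insert {x, y} (E \<union> M)) x' b' y'" by simp
      have "corner (E \<union> M) x' b' y'"
        by (rule essential_edge_creates_no_corner[OF EM _ xy b co c' b']) (rule UM)
      then show "corner E x' b' y'" using M(2) b' by (auto simp: Q_def)
    qed
    then have "{x, y} \<in> M" by (rule max[OF e])
    then show False using co by (auto simp: corner_def)
  qed
  \<comment> \<open>As \<open>M\<close> is part of \<open>F\<close>, the same \<open>F\<close> still
    completes the graph induced on \<open>S\<close> after \<open>M\<close> has been added.\<close>
  have "(E \<union> M) \<inter> Pow S \<union> F = E \<inter> Pow S \<union> F" using M(1) by auto
  then have no: "\<not> corner ((E \<union> M) \<inter> Pow S \<union> F) x b y" for x b y
    using F by (simp add: fills_def)
  have "\<exists>F2\<subseteq>F. \<forall>x b y. \<not> corner (E \<union> M \<union> F2) x b y"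
    by (rule completion_extends[OF EM F'(1,2), of S]) (rule centre no, assumption?)+
  then obtain F2 where F2: "F2 \<subseteq> F" "\<forall>x b y. \<not> corner (E \<union> M \<union> F2) x b y" by auto
  have eq: "E \<inter> Pow V \<union> (M \<union> F2) = E \<union> M \<union> F2" using E(2) by auto
  have sub: "M \<union> F2 \<subseteq> F" using M(1) F2(1) by simp
  have "fills E V (M \<union> F2)"
    unfolding fills_def eq
  proof (intro conjI)
    show "pairs (M \<union> F2)" using F'(1) sub by (rule pairs_subset)
    show "finite (M \<union> F2)" using sub F'(2) by (rule finite_subset)
    show "M \<union> F2 \<subseteq> Pow V" using sub F'(3) S(1) by blast
  qed (rule F2(2))
  with sub show ?thesis by blast
qed

lemma minimal_obstruction_card_le:
  assumes V: "finite V" and E: "pairs E" "E \<subseteq> Pow V" and hl: "\<And>n c. hole E n c \<Longrightarrow> n \<le> l"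
    and bad: "\<And>F. fills E V F \<Longrightarrow> p < card F"
    and good: "\<And>S. S \<subset> V \<Longrightarrow> \<exists>F. fills E S F \<and> card F \<le> p"
    and m: "m = Suc p * l"
  shows "card V \<le> m + m * m * (Suc (2 * p) * l)"
proof -
  obtain U where U: "U \<subseteq> V" "card U \<le> m"
    and alt: "(\<forall>x b y. corner E x b y \<longrightarrow> b \<notin> U \<longrightarrow> x \<in> U) \<or> (\<forall>F. fills E U F \<longrightarrow> Suc p \<le> card F)"
    using corners_outside_or_many_fills[OF E, of l "Suc p"] hl unfolding m by blast
  \<comment> \<open>A proper \<open>U\<close> has a fill with at most \<open>p\<close> edges by
    minimality, which rules out the second alternative; for \<open>U = V\<close> the claim is
    immediate.\<close>
  have U_corner: "x \<in> U" if co: "corner E x b y" "b \<notin> U" for x b y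
  proof (cases "U = V")
    case True
    then show ?thesis using co E(2) by (auto simp: corner_def)
  next
    case False
    then have "\<exists>F. fills E U F \<and> card F \<le> p" using good U by blast
    then show ?thesis using alt co by force
  qed
  have "\<exists>S\<subseteq>V. U \<subseteq> S \<and> card S \<le> card U + card U * card U * (Suc (2 * p) * l) \<and>
      (\<forall>F. fills E S F \<longrightarrow> card F \<le> p \<longrightarrow>
        (\<forall>x\<in>U. \<forall>y\<in>U. \<forall>b. corner E x b y \<longrightarrow> b \<notin> S \<longrightarrow> {x, y} \<in> F))"
    using E V hl U(1) by (rule kernel_exists)
  then obtain S where S: "S \<subseteq> V" "U \<subseteq> S" "card S \<le> card U + card U * card U * (Suc (2 * p) * l)"
    and ess: "\<forall>F. fills E S F \<longrightarrow> card F \<le> p \<longrightarrow>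
      (\<forall>x\<in>U. \<forall>y\<in>U. \<forall>b. corner E x b y \<longrightarrow> b \<notin> S \<longrightarrow> {x, y} \<in> F)"
    by (elim exE conjE)
  have "S = V"
  proof (rule ccontr)
    assume "S \<noteq> V"
    then obtain F where F: "fills E S F" "card F \<le> p" using good S(1) by blast
    have "\<exists>F'\<subseteq>F. fills E V F'"
      by (rule fills_kernel[OF E S(1,2) F(1)]) (use ess F U_corner in simp_all)
    then obtain F' where F': "F' \<subseteq> F" "fills E V F'" by blast
    then have "p < card F'" by (intro bad)
    moreover have "card F' \<le> card F" using F(1) F'(1) by (auto simp: fills_def intro: card_mono)
    ultimately show False using F(2) by simp
  qed
  moreover have "card U + card U * card U * (Suc (2 * p) * l) \<le> m + m * m * (Suc (2 * p) * l)"
    using U(2) by (intro add_le_mono mult_le_mono order_refl)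
  ultimately show ?thesis using S(3) by (auto intro: order_trans)
qed

subsection \<open>Forbidden induced subgraphs\<close>

lemma cycle_graph_edge_iff:
  assumes "i < n" "j < n"
  shows "{i, j} \<in> edges (cycle_graph n) \<longleftrightarrow> j = Suc i mod n \<or> i = Suc j mod n"
  using assms by (auto simp: cycle_graph_def doubleton_eq_iff)

text \<open>The labelling \<open>c\<close> of a hole is itself the isomorphism from the standard
  cycle.\<close>

lemma graph_iso_cycle_graph_iff:
  assumes "4 \<le> n"
  shows "graph_iso G (cycle_graph n) \<longleftrightarrow> (\<exists>c. hole (edges G) n c \<and> c ` {..<n} = verts G)"
proof
  assume "graph_iso G (cycle_graph n)"
  then obtain c where c: "bij_betw c (verts (cycle_graph n)) (verts G)"
    and e: "\<forall>u\<in>verts (cycle_graph n). \<forall>v\<in>verts (cycle_graph n).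
      {u, v} \<in> edges (cycle_graph n) \<longleftrightarrow> {c u, c v} \<in> edges G"
    using graph_iso_sym[of G "cycle_graph n"] unfolding graph_iso_def by blast
  have v: "verts (cycle_graph n) = {..<n}" by (simp add: cycle_graph_def)
  have "hole (edges G) n c" using c e assms unfolding v
    by (auto simp: hole_def bij_betw_def cycle_graph_edge_iff)
  then show "\<exists>c. hole (edges G) n c \<and> c ` {..<n} = verts G"
    using c unfolding v by (auto simp: bij_betw_def)
next
  assume "\<exists>c. hole (edges G) n c \<and> c ` {..<n} = verts G"
  then obtain c where c: "hole (edges G) n c" "c ` {..<n} = verts G" by blast
  then have "graph_iso (cycle_graph n) G"
    unfolding graph_iso_def
    by (intro exI[of _ c]) (auto simp: bij_betw_def hole_def cycle_graph_edge_iff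
        cycle_graph_def[of n, THEN arg_cong[of _ _ verts]])
  then show "graph_iso G (cycle_graph n)" by (rule graph_iso_sym)
qed

lemma simple_graph_pairs:
  "simple_graph G \<Longrightarrow> pairs (edges G)" "simple_graph G \<Longrightarrow> edges G \<subseteq> Pow (verts G)"
  by (auto simp: simple_graph_def pairs_def)

lemma edges_induced_subgraph: "edges (induced_subgraph G S) = edges G \<inter> Pow S"
  by (auto simp: induced_subgraph_def)

lemma verts_induced_subgraph: "verts (induced_subgraph G S) = S"
  by (simp add: induced_subgraph_def)

lemma hole_restrict:
  assumes "c ` {..<n} \<subseteq> S"
  shows "hole (E \<inter> Pow S) n c \<longleftrightarrow> hole E n c"
  using assms by (auto simp: hole_def image_subset_iff)

text \<open>Holes mediate: by \<open>hole_restrict\<close>, an induced cycle on \<open>S\<close> is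
  the same as a hole of \<open>G\<close> with vertex set \<open>S\<close>.\<close>

lemma chordal_iff_no_corner:
  assumes "simple_graph G"
  shows "chordal G \<longleftrightarrow> (\<forall>x b y. \<not> corner (edges G) x b y)"
proof -
  note E = simple_graph_pairs[OF assms]
  have "chordal G \<longleftrightarrow> \<not> (\<exists>n c. hole (edges G) n c)"
  proof
    assume ch: "chordal G"
    show "\<not> (\<exists>n c. hole (edges G) n c)"
    proof
      assume "\<exists>n c. hole (edges G) n c"
      then obtain n c where h: "hole (edges G) n c" by blast
      let ?S = "c ` {..<n}"
      have n: "4 \<le> n" using h by (simp add: hole_def)
      have "graph_iso (induced_subgraph G ?S) (cycle_graph n)"
        unfolding graph_iso_cycle_graph_iff[OF n] edges_induced_subgraph verts_induced_subgraph
        using h hole_restrict[of c n ?S] by blast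
      then show False using ch n hole_vertices[OF E h] unfolding chordal_def by fastforce
    qed
  next
    assume no: "\<not> (\<exists>n c. hole (edges G) n c)"
    show "chordal G"
      unfolding chordal_def
    proof (rule notI, elim exE conjE)
      fix S and n :: nat
      assume "3 < n" and i: "graph_iso (induced_subgraph G S) (cycle_graph n)"
      then have n: "4 \<le> n" by simp
      obtain c where "hole (edges G \<inter> Pow S) n c" "c ` {..<n} = S"
        using i unfolding graph_iso_cycle_graph_iff[OF n] edges_induced_subgraph
          verts_induced_subgraph by blast
      then show False using no hole_restrict[of c n S] by auto
    qed
  qed
  also have "\<dots> \<longleftrightarrow> (\<forall>x b y. \<not> corner (edges G) x b y)"
    using corner_hole[OF E(1)] hole_imp_corner[OF _ E(1)] by metis
  finally show ?thesis .
qed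

lemma edge_add_chordal_iff:
  assumes "simple_graph G"
  shows "G \<in> edge_add_chordal p \<longleftrightarrow> (\<exists>F. fills (edges G) (verts G) F \<and> card F \<le> p)"
proof -
  note E = simple_graph_pairs[OF assms]
  have finV: "finite (verts G)" using assms by (simp add: simple_graph_def)
  have sg: "simple_graph (add_edges G A)" if "pairs A" "A \<subseteq> Pow (verts G)" for A
    using that assms by (auto simp: simple_graph_def add_edges_def pairs_def)
  have EV: "edges G \<inter> Pow (verts G) \<union> A = edges (add_edges G A)" for A
    using E(2) by (auto simp: add_edges_def)
  have chf: "chordal (add_edges G A) \<longleftrightarrow> fills (edges G) (verts G) A"
    if "pairs A" "A \<subseteq> Pow (verts G)" for A
    using chordal_iff_no_corner[OF sg[OF that]] that finite_subset[OF that(2)] finV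
    unfolding fills_def EV by simp
  show ?thesis
  proof
    assume "G \<in> edge_add_chordal p"
    then obtain A where "A \<subseteq> non_edges G" "card A \<le> p" "chordal (add_edges G A)"
      by (auto simp: edge_add_chordal_def)
    moreover from this(1) have "pairs A" "A \<subseteq> Pow (verts G)" by (auto simp: non_edges_def pairs_def)
    ultimately show "\<exists>F. fills (edges G) (verts G) F \<and> card F \<le> p" using chf by blast
  next
    assume "\<exists>F. fills (edges G) (verts G) F \<and> card F \<le> p"
    then obtain F where F: "fills (edges G) (verts G) F" "card F \<le> p" by blast
    then have F': "pairs F" "F \<subseteq> Pow (verts G)" "finite F" by (auto simp: fills_def)
    \<comment> \<open>Dropping edges already present changes neither the filled graph nor the bound,
      and leaves only non-edges.\<close>
    let ?A = "F - edges G"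
    have "?A \<subseteq> non_edges G" using F' by (auto simp: non_edges_def pairs_def)
    moreover have "card ?A \<le> p" using F(2) card_mono[of F ?A] F'(3) by auto
    moreover have "add_edges G ?A = add_edges G F" by (auto simp: add_edges_def)
    then have "chordal (add_edges G ?A)" using chf[OF F'(1,2)] F(1) by simp
    ultimately show "G \<in> edge_add_chordal p" using assms by (auto simp: edge_add_chordal_def)
  qed
qed

text \<open>The value \<open>4 * p\<close> for the length bound is where \<open>G\<close> not being
  a cycle enters: the vertex set of a hole is then proper, so it has a fill with at most
  \<open>p\<close> edges, and \<open>hole_length_le\<close> applies.\<close>

lemma forbidden_card_le:
  fixes G :: "'a ugraph"
  assumes "G \<in> forbidden_induced_subgraphs (edge_add_chordal p)" "\<not> is_cycle G"
    and m: "m = Suc p * (4 * p)"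
  shows "card (verts G) \<le> m + m * m * (Suc (2 * p) * (4 * p))"
proof (rule minimal_obstruction_card_le[OF _ _ _ _ _ _ m])
  have sG: "simple_graph G" and no: "G \<notin> edge_add_chordal p"
    and sub: "\<And>S. S \<subset> verts G \<Longrightarrow> induced_subgraph G S \<in> edge_add_chordal p"
    using assms(1) by (auto simp: forbidden_induced_subgraphs_def)
  show "finite (verts G)" using sG by (simp add: simple_graph_def)
  note E = simple_graph_pairs[OF sG]
  show "pairs (edges G)" "edges G \<subseteq> Pow (verts G)" by fact+
  show "p < card F" if "fills (edges G) (verts G) F" for F
    using no that unfolding edge_add_chordal_iff[OF sG] by fastforce
  show good: "\<exists>F. fills (edges G) S F \<and> card F \<le> p" if S: "S \<subset> verts G" for S
  proof -
    have "simple_graph (induced_subgraph G S)" using simple_graph_induced[OF sG] S by blast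
    from sub[OF S, unfolded edge_add_chordal_iff[OF this]]
    show ?thesis by (auto simp: fills_def edges_induced_subgraph verts_induced_subgraph Int_assoc)
  qed
  show "n \<le> 4 * p" if h: "hole (edges G) n c" for n c
  proof -
    have n: "4 \<le> n" using h by (simp add: hole_def)
    have "c ` {..<n} \<noteq> verts G"
    proof
      assume "c ` {..<n} = verts G"
      then have "graph_iso G (cycle_graph n)" using h graph_iso_cycle_graph_iff[OF n] by blast
      then have "is_cycle G" using n unfolding is_cycle_def by (intro exI[of _ n]) simp
      then show False using assms(2) by simp
    qed
    then obtain F where "fills (edges G) (c ` {..<n}) F" "card F \<le> p"
      using good[of "c ` {..<n}"] hole_vertices[OF E h] by blast
    then show ?thesis using hole_length_le[OF E(1) h, of F] by simp
  qed
qed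

text \<open>The vertex type may be infinite, so only classes can be counted. Each is determined by a
  copy of its graphs on an initial segment of the naturals, for which there are finitely many
  choices.\<close>

lemma finite_iso_classes:
  fixes \<A> :: "'a ugraph set"
  assumes "\<And>G. G \<in> \<A> \<Longrightarrow> simple_graph G \<and> card (verts G) \<le> N"
  shows "finite (\<A> // iso_rel)"
proof -
  \<comment> \<open>This over-counts: edge sets need not be simple or fit the vertex set, since only
    finiteness matters.\<close>
  define \<K> where "\<K> = (\<lambda>(n, X). \<lparr>verts = {..<n}, edges = X\<rparr> :: nat ugraph) ` ({..N} \<times> Pow (Pow {..<N}))"
  have "finite \<K>" unfolding \<K>_def by simp
  moreover have "\<A> // iso_rel \<subseteq> (\<lambda>K. {H :: 'a ugraph. simple_graph H \<and> graph_iso H K}) ` \<K>"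
  proof
    fix C assume "C \<in> \<A> // iso_rel"
    then obtain G where G: "G \<in> \<A>" "C = iso_rel `` {G}" by (auto simp: quotient_def)
    then have sG: "simple_graph G" and N: "card (verts G) \<le> N" using assms by auto
    let ?n = "card (verts G)"
    have "finite (verts G)" using sG by (simp add: simple_graph_def)
    then obtain f where f: "bij_betw f (verts G) {..<?n}"
      using ex_bij_betw_finite_nat[of "verts G"] by (auto simp: atLeast0LessThan)
    let ?K = "\<lparr>verts = {..<?n}, edges = (`) f ` edges G\<rparr>"
    have sub: "e \<subseteq> verts G" if "e \<in> edges G" for e using that sG by (auto simp: simple_graph_def)
    have inj: "inj_on f (verts G)" using f by (simp add: bij_betw_def)
    have GK: "graph_iso G ?K"
      unfolding graph_iso_def
    proof (intro exI[of _ f] conjI ballI)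
      fix u v assume uv: "u \<in> verts G" "v \<in> verts G"
      show "{u, v} \<in> edges G \<longleftrightarrow> {f u, f v} \<in> edges ?K"
      proof
        assume "{f u, f v} \<in> edges ?K"
        then obtain e where e: "e \<in> edges G" "f ` e = f ` {u, v}" by auto
        then have "e = {u, v}" using inj_on_image_eq_iff[OF inj sub[OF e(1)], of "{u, v}"] uv by auto
        then show "{u, v} \<in> edges G" using e by simp
      next
        assume "{u, v} \<in> edges G"
        then have "f ` {u, v} \<in> (`) f ` edges G" by (rule imageI)
        then show "{f u, f v} \<in> edges ?K" by simp
      qed
    qed (use f in simp)
    have "(`) f ` edges G \<subseteq> Pow {..<N}"
    proof (intro subsetI PowI)
      fix e' i assume "e' \<in> (`) f ` edges G" "i \<in> e'"
      then have "i \<in> f ` verts G" using sub by blast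
      then show "i \<in> {..<N}" using f N by (simp add: bij_betw_def)
    qed
    then have "?K \<in> \<K>" using N by (auto simp: \<K>_def)
    moreover have "C = {H. simple_graph H \<and> graph_iso H ?K}"
      unfolding G(2) iso_rel_def using sG GK by (auto intro: graph_iso_sym graph_iso_trans)
    ultimately show "C \<in> (\<lambda>K. {H. simple_graph H \<and> graph_iso H K}) ` \<K>" by blast
  qed
  ultimately show ?thesis using finite_surj by blast
qed

theorem theorem4p4:
  fixes p :: nat
  shows "finite ({G :: 'a ugraph.
      G \<in> forbidden_induced_subgraphs (edge_add_chordal p) \<and> \<not> is_cycle G} // iso_rel)"
  by (rule finite_iso_classes)
    (use forbidden_card_le in \<open>auto simp: forbidden_induced_subgraphs_def\<close>)

end
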